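(* Let $A$ be a complex Banach space, let $\varphi\in A^*$ be non-zero with $\|\varphi\|\le 1$, and let ${}_\varphi A$ denote $A$ with the Banach algebra product $a\cdot b=\langle\varphi,a\rangle b$. Then for each $n\in\mathbb{N}$, ${}_\varphi A$ is $(2n-1)$-weakly amenable. Moreover, if $\dim(\ker\varphi)\ge 2$, then ${}_\varphi A$ is not $(2n)$-weakly amenable for any $n\in\mathbb{N}$.
   Context: $\mathbb{N}=\{1,2,3,\dots\}$. For a Banach algebra $B$ and a Banach $B$-bimodule $X$, the dual $X^*$ is a Banach $B$-bimodule via $\langle f\cdot a,x\rangle=\langle f,a\cdot x\rangle$ and $\langle a\cdot f,x\rangle=\langle f,x\cdot a\rangle$; starting from $B$ acting on itself by multiplication, this makes every $n$-th dual $B^{(n)}$ a Banach $B$-bimodule. A derivation from $B$ to $X$ is a bounded linear map $D:B\to X$ with $D(ab)=D(a)\cdot b+a\cdot D(b)$ for all $a,b\in B$; it is inner if there is $x\in X$ with $D(a)=a\cdot x-x\cdot a$ for all $a\in B$. $B$ is $n$-weakly amenable if every derivation from $B$ into $B^{(n)}$ is inner. *)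

theory Defs
  imports "HOL-Analysis.Analysis"
begin

section \<open>Complex Banach spaces\<close>

text \<open>The library only has real Banach spaces; a complex Banach space is a real one with
  a compatible complex scalar multiplication.\<close>

class complex_banach = banach +
  fixes scaleC :: "complex \<Rightarrow> 'a \<Rightarrow> 'a" (infixr "*\<^sub>C" 75)
  assumes scaleC_add_right: "c *\<^sub>C (x + y) = c *\<^sub>C x + c *\<^sub>C y"
    and scaleC_add_left: "(c + d) *\<^sub>C x = c *\<^sub>C x + d *\<^sub>C x"
    and scaleC_scaleC: "c *\<^sub>C (d *\<^sub>C x) = (c * d) *\<^sub>C x"
    and scaleC_one: "1 *\<^sub>C x = x"
    and scaleC_of_real: "complex_of_real r *\<^sub>C x = r *\<^sub>R x"
    and norm_scaleC: "norm (c *\<^sub>C x) = cmod c * norm x"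

instantiation complex :: complex_banach
begin
definition scaleC_complex :: "complex \<Rightarrow> complex \<Rightarrow> complex"
  where "scaleC_complex = (*)"
instance
  by standard (simp_all add: scaleC_complex_def algebra_simps norm_mult scaleR_conv_of_real)
end

interpretation complex_vector: vector_space "scaleC :: complex \<Rightarrow> 'a \<Rightarrow> 'a::complex_banach"
  by standard (simp_all add: scaleC_add_right scaleC_add_left scaleC_scaleC scaleC_one)

definition bounded_clinear :: "('a::complex_banach \<Rightarrow> 'b::complex_banach) \<Rightarrow> bool"
  where "bounded_clinear f \<longleftrightarrow> bounded_linear f \<and> (\<forall>c x. f (c *\<^sub>C x) = c *\<^sub>C f x)"

text \<open>The library's \<open>dim\<close> is 0 for infinite-dimensional spaces, so we speak about the
  cardinality of a basis instead.\<close>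

definition dim_at_least :: "nat \<Rightarrow> 'a::complex_banach set \<Rightarrow> bool"
  where "dim_at_least d V \<longleftrightarrow>
    (\<exists>b. \<not> complex_vector.dependent b \<and> complex_vector.span b = V \<and> (infinite b \<or> d \<le> card b))"


section \<open>Banach algebras and the product given by a functional\<close>

text \<open>The underlying Banach space of an algebra is a type; the product is a parameter, because
  one space carries many products.\<close>

locale banach_algebra =
  fixes m :: "'a::complex_banach \<Rightarrow> 'a \<Rightarrow> 'a"
  assumes mult_assoc: "m (m a b) c = m a (m b c)"
    and mult_add_left: "m (a + b) c = m a c + m b c"
    and mult_add_right: "m a (b + c) = m a b + m a c"
    and mult_scaleC_left: "m (z *\<^sub>C a) b = z *\<^sub>C m a b"
    and mult_scaleC_right: "m a (z *\<^sub>C b) = z *\<^sub>C m a b"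
    and norm_mult_le: "norm (m a b) \<le> norm a * norm b"

definition phi_mult :: "('a::complex_banach \<Rightarrow> complex) \<Rightarrow> 'a \<Rightarrow> 'a \<Rightarrow> 'a"
  where "phi_mult \<phi> a b = \<phi> a *\<^sub>C b"

lemma banach_algebra_phi_mult:
  assumes "bounded_clinear \<phi>" and "onorm \<phi> \<le> 1"
  shows "banach_algebra (phi_mult \<phi>)"
proof -
  have bl: "bounded_linear \<phi>" and hom: "\<And>c x. \<phi> (c *\<^sub>C x) = c * \<phi> x"
    using assms(1) by (auto simp: bounded_clinear_def scaleC_complex_def)
  have le: "cmod (\<phi> x) \<le> norm x" for x
    using onorm[OF bl, of x] mult_right_mono[OF assms(2) norm_ge_zero[of x]] by simp
  have mle: "cmod (\<phi> x) * norm y \<le> norm x * norm y" for x y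
    by (intro mult_right_mono le) simp
  show ?thesis
    by standard
      (simp_all add: phi_mult_def hom linear_add[OF bounded_linear.linear[OF bl]]
        scaleC_add_left scaleC_add_right scaleC_scaleC norm_scaleC mult.commute[of z for z :: complex] mle)
qed


section \<open>Bimodules and their duals\<close>

record ('a, 'v) bimodule =
  bcarrier :: "'v set"
  badd :: "'v \<Rightarrow> 'v \<Rightarrow> 'v"
  bscale :: "complex \<Rightarrow> 'v \<Rightarrow> 'v"
  bnorm :: "'v \<Rightarrow> real"
  lact :: "'a \<Rightarrow> 'v \<Rightarrow> 'v"
  ract :: "'v \<Rightarrow> 'a \<Rightarrow> 'v"

definition regular_bimodule :: "('a::complex_banach \<Rightarrow> 'a \<Rightarrow> 'a) \<Rightarrow> ('a, 'a) bimodule"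
  where "regular_bimodule m =
    \<lparr>bcarrier = UNIV, badd = (+), bscale = scaleC, bnorm = norm, lact = m, ract = m\<rparr>"

text \<open>Functionals on \<open>X\<close> are total functions; to make them unique they vanish outside the
  carrier.\<close>

definition bounded_functionals :: "('a, 'v) bimodule \<Rightarrow> ('v \<Rightarrow> complex) set"
  where "bounded_functionals X = {f.
    (\<forall>x. x \<notin> bcarrier X \<longrightarrow> f x = 0) \<and>
    (\<forall>x\<in>bcarrier X. \<forall>y\<in>bcarrier X. f (badd X x y) = f x + f y) \<and>
    (\<forall>c. \<forall>x\<in>bcarrier X. f (bscale X c x) = c * f x) \<and>
    (\<exists>K. \<forall>x\<in>bcarrier X. cmod (f x) \<le> K * bnorm X x)}"

definition dual_bimodule :: "('a, 'v) bimodule \<Rightarrow> ('a, 'v \<Rightarrow> complex) bimodule"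
  where "dual_bimodule X =
    \<lparr>bcarrier = bounded_functionals X,
     badd = (\<lambda>f g x. f x + g x),
     bscale = (\<lambda>c f x. c * f x),
     bnorm = (\<lambda>f. SUP x\<in>{x \<in> bcarrier X. bnorm X x \<le> 1}. cmod (f x)),
     lact = (\<lambda>a f x. if x \<in> bcarrier X then f (ract X x a) else 0),
     ract = (\<lambda>f a x. if x \<in> bcarrier X then f (lact X a x) else 0)\<rparr>"

text \<open>The same bimodule with its elements renamed by \<open>h\<close>, which has to be injective on the
  carrier.\<close>

definition relabel :: "('v \<Rightarrow> 'u) \<Rightarrow> ('a, 'v) bimodule \<Rightarrow> ('a, 'u) bimodule"
  where "relabel h X = (let g = inv_into (bcarrier X) h in
    \<lparr>bcarrier = h ` bcarrier X,
     badd = (\<lambda>u v. h (badd X (g u) (g v))),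
     bscale = (\<lambda>c u. h (bscale X c (g u))),
     bnorm = (\<lambda>u. bnorm X (g u)),
     lact = (\<lambda>a u. h (lact X a (g u))),
     ract = (\<lambda>u a. h (ract X (g u) a))\<rparr>)"


section \<open>Iterated duals\<close>

text \<open>The iterated duals of a space have different types, so a statement about the \<open>n\<close>-th dual
  for variable \<open>n\<close> needs them all inside one type \<open>'u\<close>. The algebra is put into \<open>'u\<close> by \<open>e\<close>, and
  the functionals on the \<open>k\<close>-th dual are put into \<open>'u\<close> by \<open>c k\<close>. The names are
  immaterial as long as no two elements are identified up to level \<open>n\<close>; this is
  \<open>dual_coding\<close>. It is important to require this only up to level \<open>n\<close>: a suitable type \<open>'u\<close> then
  always exists (see \<open>full_coding_0\<close>, \<open>full_coding_Suc\<close> and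
  \<open>full_coding_imp_dual_coding\<close> below), whereas in general no
  type can hold the duals of all levels.\<close>

primrec nth_dual :: "('a \<Rightarrow> 'u) \<Rightarrow> (nat \<Rightarrow> ('u \<Rightarrow> complex) \<Rightarrow> 'u) \<Rightarrow>
    ('a::complex_banach \<Rightarrow> 'a \<Rightarrow> 'a) \<Rightarrow> nat \<Rightarrow> ('a, 'u) bimodule"
  where
    "nth_dual e c m 0 = relabel e (regular_bimodule m)"
  | "nth_dual e c m (Suc k) = relabel (c k) (dual_bimodule (nth_dual e c m k))"

definition dual_coding :: "('a \<Rightarrow> 'u) \<Rightarrow> (nat \<Rightarrow> ('u \<Rightarrow> complex) \<Rightarrow> 'u) \<Rightarrow>
    ('a::complex_banach \<Rightarrow> 'a \<Rightarrow> 'a) \<Rightarrow> nat \<Rightarrow> bool"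
  where "dual_coding e c m n \<longleftrightarrow>
    inj e \<and> (\<forall>k<n. inj_on (c k) (bounded_functionals (nth_dual e c m k)))"


section \<open>Derivations and weak amenability\<close>

definition derivation :: "('a::complex_banach \<Rightarrow> 'a \<Rightarrow> 'a) \<Rightarrow> ('a, 'v) bimodule \<Rightarrow> ('a \<Rightarrow> 'v) \<Rightarrow> bool"
  where "derivation m X D \<longleftrightarrow>
    range D \<subseteq> bcarrier X \<and>
    (\<forall>a b. D (a + b) = badd X (D a) (D b)) \<and>
    (\<forall>z a. D (z *\<^sub>C a) = bscale X z (D a)) \<and>
    (\<exists>K. \<forall>a. bnorm X (D a) \<le> K * norm a) \<and>
    (\<forall>a b. D (m a b) = badd X (ract X (D a) b) (lact X a (D b)))"

definition inner_derivation :: "('a, 'v) bimodule \<Rightarrow> ('a \<Rightarrow> 'v) \<Rightarrow> bool"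
  where "inner_derivation X D \<longleftrightarrow>
    (\<exists>x\<in>bcarrier X. \<forall>a. D a = badd X (lact X a x) (bscale X (- 1) (ract X x a)))"

definition n_weakly_amenable :: "('a \<Rightarrow> 'u) \<Rightarrow> (nat \<Rightarrow> ('u \<Rightarrow> complex) \<Rightarrow> 'u) \<Rightarrow>
    ('a::complex_banach \<Rightarrow> 'a \<Rightarrow> 'a) \<Rightarrow> nat \<Rightarrow> bool"
  where "n_weakly_amenable e c m n \<longleftrightarrow>
    (\<forall>D. derivation m (nth_dual e c m n) D \<longrightarrow> inner_derivation (nth_dual e c m n) D)"


section \<open>Existence of codings at every finite level\<close>

text \<open>To extend a coding by one level it is enough to code all functions supported on a set
  that contains the carrier.\<close>

primrec code_level :: "('a \<Rightarrow> 'u) \<Rightarrow> (nat \<Rightarrow> ('u \<Rightarrow> complex) \<Rightarrow> 'u) \<Rightarrow> nat \<Rightarrow> 'u set"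
  where
    "code_level e c 0 = range e"
  | "code_level e c (Suc k) = c k ` {f. \<forall>x. x \<notin> code_level e c k \<longrightarrow> f x = 0}"

definition full_coding :: "('a \<Rightarrow> 'u) \<Rightarrow> (nat \<Rightarrow> ('u \<Rightarrow> complex) \<Rightarrow> 'u) \<Rightarrow> nat \<Rightarrow> bool"
  where "full_coding e c n \<longleftrightarrow>
    inj e \<and> (\<forall>k<n. inj_on (c k) {f. \<forall>x. x \<notin> code_level e c k \<longrightarrow> f x = 0})"

lemma bcarrier_nth_dual_subset: "bcarrier (nth_dual e c m k) \<subseteq> code_level e c k"
proof (induction k)
  case 0
  then show ?case by (auto simp: relabel_def regular_bimodule_def Let_def)
next
  case (Suc k)
  then show ?case
    by (auto simp: relabel_def dual_bimodule_def Let_def bounded_functionals_def intro!: imageI)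
qed

lemma full_coding_imp_dual_coding:
  assumes "full_coding e c n"
  shows "dual_coding e c m n"
  unfolding dual_coding_def
proof (intro conjI allI impI)
  show "inj e" using assms by (simp add: full_coding_def)
next
  fix k assume "k < n"
  then have "inj_on (c k) {f. \<forall>x. x \<notin> code_level e c k \<longrightarrow> f x = 0}"
    using assms by (simp add: full_coding_def)
  moreover have "bounded_functionals (nth_dual e c m k) \<subseteq> {f. \<forall>x. x \<notin> code_level e c k \<longrightarrow> f x = 0}"
    using bcarrier_nth_dual_subset[of e c m k] by (auto simp: bounded_functionals_def)
  ultimately show "inj_on (c k) (bounded_functionals (nth_dual e c m k))"
    by (rule inj_on_subset)
qed

lemma full_coding_0: "full_coding (\<lambda>x::'a. x) c 0"
  by (simp add: full_coding_def)

lemma full_coding_Suc: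
  fixes e :: "'a \<Rightarrow> 'u"
  assumes "full_coding e c n"
  shows "\<exists>(e' :: 'a \<Rightarrow> 'u + ('u \<Rightarrow> complex)) c'. full_coding e' c' (Suc n)"
proof -
  define e' :: "'a \<Rightarrow> 'u + ('u \<Rightarrow> complex)" where "e' = Inl \<circ> e"
  define c' :: "nat \<Rightarrow> ('u + ('u \<Rightarrow> complex) \<Rightarrow> complex) \<Rightarrow> 'u + ('u \<Rightarrow> complex)"
    where "c' k f = (if k < n then Inl (c k (f \<circ> Inl)) else Inr (f \<circ> Inl))" for k f
  let ?S = "\<lambda>U. {f. \<forall>x. x \<notin> U \<longrightarrow> f x = (0::complex)}"
  have supp: "(\<lambda>f. f \<circ> Inl) ` ?S (Inl ` U :: ('u + ('u \<Rightarrow> complex)) set) = ?S U" for U :: "'u set"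
  proof (intro equalityI subsetI)
    fix g assume g: "g \<in> ?S U"
    have "g = case_sum g (\<lambda>_. 0) \<circ> (Inl :: 'u \<Rightarrow> 'u + ('u \<Rightarrow> complex))" by auto
    moreover have "case_sum g (\<lambda>_. 0) \<in> ?S (Inl ` U :: ('u + ('u \<Rightarrow> complex)) set)"
      using g by (auto split: sum.split)
    ultimately show "g \<in> (\<lambda>f. f \<circ> Inl) ` ?S (Inl ` U :: ('u + ('u \<Rightarrow> complex)) set)"
      by (rule image_eqI)
  qed auto
  have inj_restr: "inj_on (\<lambda>f. f \<circ> Inl) (?S (Inl ` U :: ('u + ('u \<Rightarrow> complex)) set))" for U :: "'u set"
  proof (rule inj_onI, rule ext)
    fix f g :: "'u + ('u \<Rightarrow> complex) \<Rightarrow> complex" and x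
    assume "f \<in> ?S (Inl ` U)" "g \<in> ?S (Inl ` U)" "f \<circ> Inl = g \<circ> Inl"
    then show "f x = g x"
      by (cases x) (simp_all add: fun_eq_iff image_iff)
  qed
  have level: "k \<le> n \<Longrightarrow> code_level e' c' k = Inl ` code_level e c k" for k
  proof (induction k)
    case 0
    then show ?case by (auto simp: e'_def)
  next
    case (Suc k)
    then have lk: "code_level e' c' k = Inl ` code_level e c k" by simp
    have ck: "c' k = (\<lambda>f. Inl (c k (f \<circ> Inl)))"
      using Suc.prems by (simp add: fun_eq_iff c'_def)
    have "code_level e' c' (Suc k) = (\<lambda>f. Inl (c k (f \<circ> Inl))) ` ?S 
        (Inl ` code_level e c k :: ('u + ('u \<Rightarrow> complex)) set)"
      by (simp only: code_level.simps lk ck)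
    also have "\<dots> = (\<lambda>g. Inl (c k g)) ` (\<lambda>f. f \<circ> Inl) ` ?S 
        (Inl ` code_level e c k :: ('u + ('u \<Rightarrow> complex)) set)"
      by (simp add: image_image)
    finally show ?case by (simp only: supp) (simp add: image_image)
  qed
  have "full_coding e' c' (Suc n)"
    unfolding full_coding_def
  proof (intro conjI allI impI)
    show "inj e'"
      using assms by (auto simp: full_coding_def e'_def inj_on_def)
  next
    fix k assume k: "k < Suc n"
    have lk: "code_level e' c' k = Inl ` code_level e c k" using level k by simp
    show "inj_on (c' k) (?S (code_level e' c' k))"
    proof (cases "k < n")
      case True
      have "inj_on (c k) ((\<lambda>f. f \<circ> Inl) ` ?S (Inl ` code_level e c k :: ('u + ('u \<Rightarrow> complex)) set))"
        using assms True by (simp only: supp) (simp add: full_coding_def)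
      from comp_inj_on[OF inj_restr this] show ?thesis
        unfolding lk using True by (simp add: c'_def inj_on_def)
    next
      case False
      then show ?thesis
        using inj_restr[of "code_level e c k"] unfolding lk by (simp add: c'_def inj_on_def)
    qed
  qed
  then show ?thesis by blast
qed

end

theory Submission
  imports Defs
begin

text \<open>Write \<open>\<iota>\<close> for the canonical embeddings into even duals. In the \<open>2n\<close>-th dual
  \<open>a \<cdot> F = \<phi> a F\<close> and \<open>F \<cdot> a = F(\<phi>) \<iota> a\<close>; in the \<open>(2n-1)\<close>-st dual \<open>f \<cdot> a = \<phi> a f\<close> and
  \<open>a \<cdot> f = f(\<iota> a) \<phi>\<close>. Hence a derivation \<open>D\<close> into an odd dual satisfies
  \<open>\<phi> a D b = \<phi> b D a + (D b)(\<iota> a) \<phi>\<close>, which for \<open>\<phi> b = 1\<close> says that \<open>- D b\<close> implements \<open>D\<close>.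
  Into an even dual every bounded linear map with values in the annihilator of \<open>\<phi>\<close> is a
  derivation, in particular \<open>a \<mapsto> \<psi> a \<iota> u\<close> with \<open>\<phi> u = 0\<close>; but inner derivations are multiples of
  \<open>\<iota>\<close> on \<open>ker \<phi>\<close>. A functional \<open>\<psi>\<close> with \<open>\<psi> u \<noteq> 0\<close> comes from the Hahn-Banach theorem, proved
  here by the fact that a minimal sublinear functional is linear.\<close>

section \<open>Separation of points by bounded functionals\<close>

text \<open>Homogeneity is asked as an inequality only, the form that passes to infima; equality
  follows by also applying it to \<open>inverse r\<close>.\<close>

definition sublinear :: "('a::real_vector \<Rightarrow> real) \<Rightarrow> bool"
  where "sublinear q \<longleftrightarrow>
    (\<forall>x y. q (x + y) \<le> q x + q y) \<and> (\<forall>r\<ge>0. \<forall>x. q (r *\<^sub>R x) \<le> r * q x)"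

lemma sublinear_add: "sublinear q \<Longrightarrow> q (x + y) \<le> q x + q y"
  by (simp add: sublinear_def)

lemma sublinear_scale_le: "sublinear q \<Longrightarrow> 0 \<le> r \<Longrightarrow> q (r *\<^sub>R x) \<le> r * q x"
  by (simp add: sublinear_def)

lemma sublinear_zero: "sublinear q \<Longrightarrow> q 0 = 0"
  using sublinear_add[of q 0 0] sublinear_scale_le[of q 0 0] by simp

lemma sublinear_ge_minus: "sublinear q \<Longrightarrow> - q (- x) \<le> q x"
  using sublinear_add[of q x "- x"] sublinear_zero[of q] by simp

lemma sublinear_scale:
  assumes "sublinear q" "0 \<le> r"
  shows "q (r *\<^sub>R x) = r * q x"
proof (cases "r = 0")
  case True
  then show ?thesis by (simp add: sublinear_zero[OF assms(1)])
next
  case False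
  then have "q x \<le> inverse r * q (r *\<^sub>R x)"
    using sublinear_scale_le[OF assms(1), of "inverse r" "r *\<^sub>R x"] assms(2) by simp
  then have "r * q x \<le> q (r *\<^sub>R x)"
    using False assms(2) by (simp add: field_simps)
  then show ?thesis using sublinear_scale_le[OF assms] by (simp add: antisym)
qed

text \<open>Serves both the family that defines \<open>tilt\<close> and the chains in Zorn's lemma.
  The condition \<open>zero\<close> covers the factor 0, which \<open>scale\<close> leaves
  out.\<close>

lemma sublinear_INF:
  assumes "F \<noteq> {}" and bdd: "\<And>x. bdd_below ((\<lambda>f. f x) ` F)"
    and add: "\<And>f g. f \<in> F \<Longrightarrow> g \<in> F \<Longrightarrow> \<exists>h\<in>F. \<forall>x y. h (x + y) \<le> f x + g y"
    and zero: "\<exists>h\<in>F. h 0 \<le> (0::real)"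
    and scale: "\<And>f r. f \<in> F \<Longrightarrow> 0 < r \<Longrightarrow> \<exists>h\<in>F. \<forall>x. h (r *\<^sub>R x) \<le> r * f x"
  shows "sublinear (\<lambda>x. INF f\<in>F. f x)"
proof -
  let ?q = "\<lambda>x. INF f\<in>F. f x"
  have lower: "?q x \<le> f x" if "f \<in> F" for f x
    using bdd that by (rule cINF_lower)
  have "?q (x + y) \<le> ?q x + ?q y" for x y
  proof -
    \<comment> \<open>The infimum is taken over \<open>f\<close> with \<open>g\<close> fixed, and
      afterwards over \<open>g\<close>.\<close>
    have "?q (x + y) - g y \<le> ?q x" if g: "g \<in> F" for g
    proof (rule cINF_greatest[OF \<open>F \<noteq> {}\<close>])
      fix f assume "f \<in> F"
      then obtain h where "h \<in> F" "h (x + y) \<le> f x + g y" using add[OF _ g] by blast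
      then show "?q (x + y) - g y \<le> f x" using lower[of h "x + y"] by simp
    qed
    then have "?q (x + y) - ?q x \<le> ?q y"
      by (intro cINF_greatest[OF \<open>F \<noteq> {}\<close>]) (simp add: algebra_simps)
    then show ?thesis by simp
  qed
  moreover have "?q (r *\<^sub>R x) \<le> r * ?q x" if "0 \<le> r" for r x
  proof (cases "r = 0")
    case True
    then show ?thesis using zero lower[of _ 0] by force
  next
    case False
    with that have r: "0 < r" by simp
    have "?q (r *\<^sub>R x) / r \<le> ?q x"
    proof (rule cINF_greatest[OF \<open>F \<noteq> {}\<close>])
      fix f assume "f \<in> F"
      then obtain h where "h \<in> F" "h (r *\<^sub>R x) \<le> r * f x" using scale[OF _ r] by blast
      then show "?q (r *\<^sub>R x) / r \<le> f x"
        using lower[of h "r *\<^sub>R x"] r by (simp add: field_simps)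
    qed
    then show ?thesis using r by (simp add: field_simps)
  qed
  ultimately show ?thesis by (simp add: sublinear_def)
qed

text \<open>The largest sublinear functional below \<open>q\<close> whose value at \<open>- v\<close> is \<open>- q v\<close>.\<close>

definition tilt :: "('a::real_vector \<Rightarrow> real) \<Rightarrow> 'a \<Rightarrow> 'a \<Rightarrow> real"
  where "tilt q v x = (INF f\<in>(\<lambda>t y. q (y + t *\<^sub>R v) - t * q v) ` {0..}. f x)"

text \<open>The bound is independent of \<open>t\<close>, by subadditivity for
  \<open>t *\<^sub>R v = (x + t *\<^sub>R v) + (- x)\<close>.\<close>

lemma tilt_bdd_below:
  assumes "sublinear q"
  shows "bdd_below ((\<lambda>f. f x) ` (\<lambda>t y. q (y + t *\<^sub>R v) - t * q v) ` {0..})"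
proof (rule bdd_belowI)
  fix z assume "z \<in> (\<lambda>f. f x) ` (\<lambda>t y. q (y + t *\<^sub>R v) - t * q v) ` {0..}"
  then obtain t where t: "0 \<le> t" "z = q (x + t *\<^sub>R v) - t * q v" by auto
  show "- q (- x) \<le> z"
    using sublinear_add[OF assms, of "x + t *\<^sub>R v" "- x"] sublinear_scale[OF assms t(1), of v] t(2)
    by simp
qed

lemma tilt_le:
  assumes "sublinear q" "0 \<le> t"
  shows "tilt q v x \<le> q (x + t *\<^sub>R v) - t * q v"
  unfolding tilt_def
  using cINF_lower[OF tilt_bdd_below[OF assms(1), of x v], of "\<lambda>y. q (y + t *\<^sub>R v) - t * q v"]
    assms(2) by simp

text \<open>Parameters \<open>s\<close> and \<open>t\<close> combine to \<open>s + t\<close> under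
  addition, scaling by \<open>r\<close> turns \<open>s\<close> into \<open>r * s\<close>, and
  \<open>t = 0\<close> gives \<open>q\<close> itself.\<close>

lemma sublinear_tilt:
  assumes q: "sublinear q"
  shows "sublinear (tilt q v)"
proof -
  let ?F = "(\<lambda>t y. q (y + t *\<^sub>R v) - t * q v) ` {0..}"
  have "sublinear (\<lambda>x. INF f\<in>?F. f x)"
  proof (rule sublinear_INF)
    fix f g assume "f \<in> ?F" "g \<in> ?F"
    then obtain s t where s: "0 \<le> s" "f = (\<lambda>y. q (y + s *\<^sub>R v) - s * q v)"
      and t: "0 \<le> t" "g = (\<lambda>y. q (y + t *\<^sub>R v) - t * q v)" by auto
    have "q (x + y + (s + t) *\<^sub>R v) - (s + t) * q v \<le> f x + g y" for x y
      using sublinear_add[OF q, of "x + s *\<^sub>R v" "y + t *\<^sub>R v"] s t by (simp add: algebra_simps)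
    then show "\<exists>h\<in>?F. \<forall>x y. h (x + y) \<le> f x + g y"
      using s t by (intro bexI[of _ "\<lambda>y. q (y + (s + t) *\<^sub>R v) - (s + t) * q v"]) auto
  next
    fix f and r :: real assume "f \<in> ?F" "0 < r"
    then obtain s where s: "0 \<le> s" "f = (\<lambda>y. q (y + s *\<^sub>R v) - s * q v)" by auto
    have "q (r *\<^sub>R x + (r * s) *\<^sub>R v) - (r * s) * q v \<le> r * f x" for x
      using sublinear_scale_le[OF q, of r "x + s *\<^sub>R v"] s \<open>0 < r\<close> by (simp add: algebra_simps)
    then show "\<exists>h\<in>?F. \<forall>x. h (r *\<^sub>R x) \<le> r * f x"
      using s \<open>0 < r\<close> by (intro bexI[of _ "\<lambda>y. q (y + (r * s) *\<^sub>R v) - (r * s) * q v"]) auto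
  next
    show "\<exists>h\<in>?F. h 0 \<le> 0"
      using sublinear_zero[OF q] by (auto intro!: bexI[of _ "0::real"])
  qed (use tilt_bdd_below[OF q] in auto)
  then show ?thesis by (simp add: tilt_def[abs_def])
qed

text \<open>\<open>tilt q v\<close> lies below \<open>q\<close> (take \<open>t = 0\<close>), so by
  minimality it equals \<open>q\<close>. With \<open>t = 1\<close> this reads
  \<open>q x \<le> q (x + v) - q v\<close>, the converse of subadditivity.\<close>

lemma minimal_sublinear_linear:
  assumes q: "sublinear q" and min: "\<And>f. sublinear f \<Longrightarrow> f \<le> q \<Longrightarrow> f = q"
  shows "linear q"
proof -
  have tilt: "tilt q v = q" for v
    by (rule min[OF sublinear_tilt[OF q]]) (use tilt_le[OF q, of 0 v] in \<open>simp add: le_fun_def\<close>)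
  have add: "q (x + v) = q x + q v" for x v
    using tilt_le[OF q, of 1 v x] sublinear_add[OF q, of x v] by (simp add: tilt)
  have neg: "q (- x) = - q x" for x
    using add[of x "- x"] sublinear_zero[OF q] by simp
  have "q (r *\<^sub>R x) = r * q x" for r x
    using sublinear_scale[OF q, of r x] sublinear_scale[OF q, of "- r" x] neg[of "r *\<^sub>R x"]
    by (cases "0 \<le> r") auto
  with add show ?thesis by (intro linearI) auto
qed

lemma exists_linear_below_sublinear:
  assumes p: "sublinear p"
  obtains f where "linear f" "\<And>x. f x \<le> p x"
proof -
  define A where "A = {q. sublinear q \<and> q \<le> p}"
  \<comment> \<open>The order is reversed, so that Zorn's lemma yields a minimal functional. Chains
    are bounded by their pointwise infimum, the empty one by \<open>p\<close>.\<close>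
  let ?P = "\<lambda>f g :: 'a \<Rightarrow> real. g \<le> f"
  have "\<exists>m\<in>A. \<forall>a\<in>A. ?P m a \<longrightarrow> a = m"
  proof (rule predicate_Zorn)
    show "partial_order_on A (relation_of ?P A)"
      by (rule partial_order_on_relation_ofI) auto
  next
    fix C assume C: "C \<in> Chains (relation_of ?P A)"
    then have CA: "C \<subseteq> A" and chain: "\<And>f g. f \<in> C \<Longrightarrow> g \<in> C \<Longrightarrow> f \<le> g \<or> g \<le> f"
      by (auto simp: Chains_def relation_of_def)
    show "\<exists>u\<in>A. \<forall>a\<in>C. ?P a u"
    proof (cases "C = {}")
      case True
      then show ?thesis using p by (auto simp: A_def)
    next
      case False
      let ?u = "\<lambda>x. INF f\<in>C. f x"
      \<comment> \<open>The infimum is finite: \<open>f x \<ge> - f (- x) \<ge> - p (- x)\<close>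
        for every sublinear \<open>f\<close> below \<open>p\<close>.\<close>
      have bdd: "bdd_below ((\<lambda>f. f x) ` C)" for x
      proof (rule bdd_belowI)
        fix z assume "z \<in> (\<lambda>f. f x) ` C"
        then obtain f where f: "sublinear f" "f \<le> p" "z = f x" using CA by (auto simp: A_def)
        then show "- p (- x) \<le> z"
          using sublinear_ge_minus[OF f(1), of x] by (smt (verit) le_funD)
      qed
      have lower: "?u \<le> f" if "f \<in> C" for f
        using cINF_lower[OF bdd that] by (simp add: le_fun_def)
      have "sublinear ?u"
      proof (rule sublinear_INF[OF False bdd])
        fix f g assume fg: "f \<in> C" "g \<in> C"
        then obtain h where h: "h \<in> C" "h \<le> f" "h \<le> g" using chain by blast
        then have "sublinear h" using CA by (auto simp: A_def)
        then have "h (x + y) \<le> f x + g y" for x y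
          using sublinear_add[of h x y] le_funD[OF h(2), of x] le_funD[OF h(3), of y] by simp
        then show "\<exists>h\<in>C. \<forall>x y. h (x + y) \<le> f x + g y" using h(1) by blast
      next
        show "\<exists>h\<in>C. h 0 \<le> 0" using False CA sublinear_zero by (fastforce simp: A_def)
      next
        fix f and r :: real assume "f \<in> C" "0 < r"
        then show "\<exists>h\<in>C. \<forall>x. h (r *\<^sub>R x) \<le> r * f x"
          using CA by (intro bexI[of _ f]) (auto simp: A_def intro!: sublinear_scale_le)
      qed
      moreover have "?u \<le> p"
      proof -
        obtain f where "f \<in> C" using False by blast
        then have "?u \<le> f" "f \<le> p" using lower CA by (auto simp: A_def)
        then show ?thesis by (rule order_trans)
      qed
      ultimately show ?thesis using lower by (intro bexI[of _ ?u]) (auto simp: A_def)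
    qed
  qed
  then obtain q where q: "sublinear q" "q \<le> p" and min: "\<And>f. f \<in> A \<Longrightarrow> f \<le> q \<Longrightarrow> f = q"
    by (auto simp: A_def)
  have "linear q"
    by (rule minimal_sublinear_linear[OF q(1)]) (use q min in \<open>auto simp: A_def intro: order_trans\<close>)
  then show thesis using that q(2) by (auto simp: le_fun_def)
qed

section \<open>Real and complex norm-bounded functionals\<close>

lemma sublinear_norm: "sublinear norm"
  by (simp add: sublinear_def norm_triangle_ineq)

text \<open>Instead of extending a functional from the line through \<open>u\<close>, the tilted
  norm is used as the bound: at \<open>- u\<close> it is at most \<open>norm 0 - norm u\<close>,
  which forces \<open>g u\<close> up to \<open>norm u\<close>.\<close>

lemma exists_linear_le_norm:
  fixes u :: "'a::real_normed_vector"
  obtains g where "linear g" "\<And>x. \<bar>g x\<bar> \<le> norm x" "norm u \<le> g u"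
proof -
  obtain g where g: "linear g" and le: "\<And>x. g x \<le> tilt norm u x"
    using exists_linear_below_sublinear[OF sublinear_tilt[OF sublinear_norm, of u]] by metis
  have gn: "g x \<le> norm x" for x
    using le[of x] tilt_le[OF sublinear_norm, of 0 u x] by simp
  have "\<bar>g x\<bar> \<le> norm x" for x
    using gn[of x] gn[of "- x"] linear_neg[OF g, of x] by simp
  moreover have "norm u \<le> g u"
    using le[of "- u"] tilt_le[OF sublinear_norm, of 1 u "- u"] linear_neg[OF g, of u] by simp
  ultimately show thesis using that g by blast
qed

lemma bounded_clinear_add: "bounded_clinear f \<Longrightarrow> f (x + y) = f x + f y"
  by (simp add: bounded_clinear_def linear_add[OF bounded_linear.linear])

lemma bounded_clinear_scale:
  fixes f :: "'a::complex_banach \<Rightarrow> complex"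
  shows "bounded_clinear f \<Longrightarrow> f (z *\<^sub>C x) = z * f x"
  by (simp add: bounded_clinear_def scaleC_complex_def)

lemma bounded_clinear_bound:
  fixes f :: "'a::complex_banach \<Rightarrow> complex"
  assumes "bounded_clinear f"
  shows "cmod (f x) \<le> onorm f * norm x"
  using assms onorm by (auto simp: bounded_clinear_def)

lemma bounded_clinearI:
  fixes f :: "'a::complex_banach \<Rightarrow> complex"
  assumes "\<And>x y. f (x + y) = f x + f y" "\<And>z x. f (z *\<^sub>C x) = z * f x"
    and "\<And>x. cmod (f x) \<le> K * norm x"
  shows "bounded_clinear f"
proof -
  have "bounded_linear f"
    by (rule bounded_linear_intro[where K = K])
      (use assms in \<open>simp_all add: mult.commute scaleR_conv_of_real flip: scaleC_of_real\<close>)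
  then show ?thesis using assms(2) by (simp add: bounded_clinear_def scaleC_complex_def)
qed

lemma exists_bounded_clinear_nonzero:
  fixes u :: "'a::complex_banach"
  assumes "u \<noteq> 0"
  obtains \<psi> :: "'a \<Rightarrow> complex" where "bounded_clinear \<psi>" "\<psi> u \<noteq> 0"
proof -
  obtain g where g: "linear g" and le: "\<And>x. \<bar>g x\<bar> \<le> norm x" and u: "norm u \<le> g u"
    using exists_linear_le_norm[of u] by metis
  \<comment> \<open>The complex linear functional with real part \<open>g\<close>.\<close>
  define \<psi> where "\<psi> x = Complex (g x) (- g (\<i> *\<^sub>C x))" for x
  have scale: "g (z *\<^sub>C x) = Re z * g x + Im z * g (\<i> *\<^sub>C x)" for z x
  proof -
    have "z *\<^sub>C x = complex_of_real (Re z) *\<^sub>C x + complex_of_real (Im z) *\<^sub>C \<i> *\<^sub>C x"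
      by (simp add: scaleC_scaleC complex_eq mult.commute flip: scaleC_add_left)
    then have "z *\<^sub>C x = Re z *\<^sub>R x + Im z *\<^sub>R (\<i> *\<^sub>C x)"
      by (simp only: scaleC_of_real)
    then show ?thesis using g by (simp add: linear_add linear_scale)
  qed
  have "bounded_clinear \<psi>"
  proof (rule bounded_clinearI)
    show "\<psi> (x + y) = \<psi> x + \<psi> y" for x y
      using g by (simp add: \<psi>_def complex_eq_iff scaleC_add_right linear_add)
    \<comment> \<open>The factor \<open>z\<close> accounts for the real part,
      \<open>\<i> * z\<close> for the imaginary part.\<close>
    show "\<psi> (z *\<^sub>C x) = z * \<psi> x" for z x
      using scale[of z x] scale[of "\<i> * z" x] by (simp add: \<psi>_def complex_eq_iff scaleC_scaleC)
    \<comment> \<open>Real and imaginary part are each bounded by \<open>norm x\<close>, as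
      multiplication by \<open>\<i>\<close> is isometric.\<close>
    show "cmod (\<psi> x) \<le> 2 * norm x" for x
      using cmod_le[of "\<psi> x"] le[of x] le[of "\<i> *\<^sub>C x"] by (simp add: \<psi>_def norm_scaleC)
  qed
  moreover have "\<psi> u \<noteq> 0" using u assms by (auto simp: \<psi>_def complex_eq_iff)
  ultimately show thesis using that by blast
qed

section \<open>Bimodules with enough functionals\<close>

text \<open>Separation of points stands in for the vector space axioms: it reduces every identity in the
  carrier to one between complex numbers.\<close>

locale separated_bimodule =
  fixes X :: "('a, 'v) bimodule"
  assumes nonempty: "bcarrier X \<noteq> {}"
    and add_closed: "x \<in> bcarrier X \<Longrightarrow> y \<in> bcarrier X \<Longrightarrow> badd X x y \<in> bcarrier X"
    and scale_closed: "x \<in> bcarrier X \<Longrightarrow> bscale X z x \<in> bcarrier X"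
    and norm_nonneg: "x \<in> bcarrier X \<Longrightarrow> 0 \<le> bnorm X x"
    and norm_scale_le: "x \<in> bcarrier X \<Longrightarrow> bnorm X (bscale X z x) \<le> cmod z * bnorm X x"
    and separation: "x \<in> bcarrier X \<Longrightarrow> y \<in> bcarrier X \<Longrightarrow>
      (\<And>f. f \<in> bounded_functionals X \<Longrightarrow> f x = f y) \<Longrightarrow> x = y"

lemma functional_outside: "f \<in> bounded_functionals X \<Longrightarrow> x \<notin> bcarrier X \<Longrightarrow> f x = 0"
  and functional_add: "f \<in> bounded_functionals X \<Longrightarrow> x \<in> bcarrier X \<Longrightarrow> y \<in> bcarrier X \<Longrightarrow>
    f (badd X x y) = f x + f y"
  and functional_scale: "f \<in> bounded_functionals X \<Longrightarrow> x \<in> bcarrier X \<Longrightarrow>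
    f (bscale X z x) = z * f x"
  by (auto simp: bounded_functionals_def)

lemma functional_bound:
  assumes "f \<in> bounded_functionals X"
  shows "\<exists>K. \<forall>x\<in>bcarrier X. cmod (f x) \<le> K * bnorm X x"
  using assms by (simp add: bounded_functionals_def)

lemma functionalI:
  assumes "\<And>x. x \<notin> bcarrier X \<Longrightarrow> f x = 0"
    and "\<And>x y. x \<in> bcarrier X \<Longrightarrow> y \<in> bcarrier X \<Longrightarrow> f (badd X x y) = f x + f y"
    and "\<And>z x. x \<in> bcarrier X \<Longrightarrow> f (bscale X z x) = z * f x"
    and "\<And>x. x \<in> bcarrier X \<Longrightarrow> cmod (f x) \<le> K * bnorm X x"
  shows "f \<in> bounded_functionals X"
  using assms unfolding bounded_functionals_def by blast

lemma functional_add_closed: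
  assumes f: "f \<in> bounded_functionals X" and g: "g \<in> bounded_functionals X"
  shows "(\<lambda>x. f x + g x) \<in> bounded_functionals X"
proof -
  obtain K L where K: "\<And>x. x \<in> bcarrier X \<Longrightarrow> cmod (f x) \<le> K * bnorm X x"
    and L: "\<And>x. x \<in> bcarrier X \<Longrightarrow> cmod (g x) \<le> L * bnorm X x"
    using functional_bound[OF f] functional_bound[OF g] by blast
  have "cmod (f x + g x) \<le> (K + L) * bnorm X x" if "x \<in> bcarrier X" for x
    using norm_triangle_ineq[of "f x" "g x"] K[OF that] L[OF that] by (simp add: algebra_simps)
  then show ?thesis
    by (intro functionalI[where K = "K + L"])
      (simp_all add: f g functional_outside[of _ X] functional_add functional_scale algebra_simps)
qed

lemma functional_scale_closed:
  assumes f: "f \<in> bounded_functionals X"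
  shows "(\<lambda>x. z * f x) \<in> bounded_functionals X"
proof -
  obtain K where K: "\<And>x. x \<in> bcarrier X \<Longrightarrow> cmod (f x) \<le> K * bnorm X x"
    using functional_bound[OF f] by blast
  have "cmod (z * f x) \<le> (cmod z * K) * bnorm X x" if "x \<in> bcarrier X" for x
    using mult_left_mono[OF K[OF that], of "cmod z"] by (simp add: norm_mult mult_ac)
  then show ?thesis
    by (intro functionalI[where K = "cmod z * K"])
      (simp_all add: f functional_outside[of _ X] functional_add functional_scale algebra_simps)
qed

section \<open>The dual norm and separation in the dual\<close>

text \<open>The canonical image of \<open>x\<close> in the bidual; it is 0 off the bounded
  functionals, as membership in the next dual requires.\<close>

definition dual_eval :: "('a, 'v) bimodule \<Rightarrow> 'v \<Rightarrow> ('v \<Rightarrow> complex) \<Rightarrow> complex"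
  where "dual_eval X x f = (if f \<in> bounded_functionals X then f x else 0)"

lemma dual_eval_apply [simp]: "f \<in> bounded_functionals X \<Longrightarrow> dual_eval X x f = f x"
  by (simp add: dual_eval_def)

lemma dual_bimodule_simps [simp]:
  "bcarrier (dual_bimodule X) = bounded_functionals X"
  "badd (dual_bimodule X) f g = (\<lambda>x. f x + g x)"
  "bscale (dual_bimodule X) z f = (\<lambda>x. z * f x)"
  by (simp_all add: dual_bimodule_def)

context separated_bimodule
begin

text \<open>The dual norm is a supremum over this ball. As the structure names no zero, 0 times any
  element is taken.\<close>

lemma unit_ball_nonempty: "{x \<in> bcarrier X. bnorm X x \<le> 1} \<noteq> {}"
proof -
  obtain x where "x \<in> bcarrier X" using nonempty by blast
  then have "bscale X 0 x \<in> {x \<in> bcarrier X. bnorm X x \<le> 1}"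
    using scale_closed norm_scale_le[of x 0] by auto
  then show ?thesis by blast
qed

lemma dual_norm_upper:
  assumes f: "f \<in> bounded_functionals X" and x: "x \<in> bcarrier X" "bnorm X x \<le> 1"
  shows "cmod (f x) \<le> bnorm (dual_bimodule X) f"
proof -
  obtain K where K: "\<And>x. x \<in> bcarrier X \<Longrightarrow> cmod (f x) \<le> K * bnorm X x"
    using functional_bound[OF f] by blast
  have "bdd_above ((\<lambda>x. cmod (f x)) ` {x \<in> bcarrier X. bnorm X x \<le> 1})"
  proof (rule bdd_aboveI2)
    fix y assume "y \<in> {x \<in> bcarrier X. bnorm X x \<le> 1}"
    then have y: "y \<in> bcarrier X" "bnorm X y \<le> 1" by auto
    \<comment> \<open>The bound \<open>K\<close> may be negative, hence its absolute value.\<close>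
    have "cmod (f y) \<le> \<bar>K\<bar> * bnorm X y"
      by (rule order_trans[OF K[OF y(1)]]) (simp add: mult_right_mono norm_nonneg y(1))
    also have "\<dots> \<le> \<bar>K\<bar>" using y(2) by (simp add: mult_left_le)
    finally show "cmod (f y) \<le> \<bar>K\<bar>" .
  qed
  then show ?thesis
    using cSUP_upper[of x "{x \<in> bcarrier X. bnorm X x \<le> 1}" "\<lambda>x. cmod (f x)"] x
    by (simp add: dual_bimodule_def)
qed

lemma dual_norm_least:
  assumes "\<And>x. x \<in> bcarrier X \<Longrightarrow> bnorm X x \<le> 1 \<Longrightarrow> cmod (f x) \<le> K"
  shows "bnorm (dual_bimodule X) f \<le> K"
  unfolding dual_bimodule_def using assms by (simp, intro cSUP_least[OF unit_ball_nonempty]) auto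

lemma dual_norm_bound:
  assumes f: "f \<in> bounded_functionals X" and x: "x \<in> bcarrier X"
  shows "cmod (f x) \<le> bnorm X x * bnorm (dual_bimodule X) f"
proof (cases "bnorm X x = 0")
  \<comment> \<open>\<open>bnorm\<close> is not assumed definite, but the bound on \<open>f\<close>
    gives \<open>f x = 0\<close> here.\<close>
  case True
  then show ?thesis using functional_bound[OF f] x by (metis mult_zero_left mult_zero_right)
next
  case False
  then have pos: "0 < bnorm X x" using norm_nonneg[OF x] by simp
  let ?y = "bscale X (complex_of_real (inverse (bnorm X x))) x"
  have "bnorm X ?y \<le> 1"
    using norm_scale_le[OF x, of "complex_of_real (inverse (bnorm X x))"] pos
    by (simp add: norm_inverse)
  then have "cmod (f ?y) \<le> bnorm (dual_bimodule X) f"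
    using dual_norm_upper[OF f scale_closed[OF x]] by blast
  then show ?thesis
    using pos by (simp add: functional_scale[OF f x] norm_mult norm_divide field_simps)
qed

lemma dual_eval_functional:
  assumes "x \<in> bcarrier X"
  shows "dual_eval X x \<in> bounded_functionals (dual_bimodule X)"
proof (rule functionalI)
  show "cmod (dual_eval X x f) \<le> bnorm X x * bnorm (dual_bimodule X) f"
    if "f \<in> bcarrier (dual_bimodule X)" for f
    using that dual_norm_bound[OF _ assms] by simp
qed (simp_all add: functional_add_closed functional_scale_closed, simp add: dual_eval_def)

text \<open>Evaluations at points of \<open>X\<close> already separate functionals, so Hahn-Banach
  is only ever applied to the algebra itself.\<close>

lemma separated_bimodule_dual: "separated_bimodule (dual_bimodule X)"
proof
  have "(\<lambda>_. 0) \<in> bounded_functionals X" by (rule functionalI[where K = 0]) auto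
  then show "bcarrier (dual_bimodule X) \<noteq> {}" by auto
next
  fix f assume f: "f \<in> bcarrier (dual_bimodule X)"
  obtain x where "x \<in> bcarrier X" "bnorm X x \<le> 1" using unit_ball_nonempty by blast
  then show "0 \<le> bnorm (dual_bimodule X) f"
    using f by (auto intro: order_trans[OF norm_ge_zero dual_norm_upper])
  show "bnorm (dual_bimodule X) (bscale (dual_bimodule X) z f) \<le> cmod z * bnorm (dual_bimodule X) f"
    for z
    using f by (intro dual_norm_least) (simp add: norm_mult mult_left_mono dual_norm_upper)
next
  fix f g
  assume fg: "f \<in> bcarrier (dual_bimodule X)" "g \<in> bcarrier (dual_bimodule X)"
    and eq: "\<And>F. F \<in> bounded_functionals (dual_bimodule X) \<Longrightarrow> F f = F g"
  show "f = g"
  proof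
    fix x
    show "f x = g x"
      using fg eq[OF dual_eval_functional[of x]] functional_outside[of f X x] functional_outside[of g X x]
      by (cases "x \<in> bcarrier X") auto
  qed
qed (simp_all add: functional_add_closed functional_scale_closed)

end

section \<open>Transport along a renaming\<close>

definition relabel_functional :: "('v \<Rightarrow> 'u) \<Rightarrow> ('a, 'v) bimodule \<Rightarrow> ('v \<Rightarrow> complex) \<Rightarrow> 'u \<Rightarrow> complex"
  where "relabel_functional h X f u =
    (if u \<in> h ` bcarrier X then f (inv_into (bcarrier X) h u) else 0)"

lemma bcarrier_relabel [simp]: "bcarrier (relabel h X) = h ` bcarrier X"
  by (simp add: relabel_def Let_def)

context
  fixes h :: "'v \<Rightarrow> 'u" and X :: "('a, 'v) bimodule"
  assumes inj: "inj_on h (bcarrier X)"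
begin

lemma relabel_simps:
  assumes "x \<in> bcarrier X"
  shows "y \<in> bcarrier X \<Longrightarrow> badd (relabel h X) (h x) (h y) = h (badd X x y)"
    "bscale (relabel h X) z (h x) = h (bscale X z x)"
    "bnorm (relabel h X) (h x) = bnorm X x"
    "lact (relabel h X) a (h x) = h (lact X a x)"
    "ract (relabel h X) (h x) a = h (ract X x a)"
    "relabel_functional h X f (h x) = f x"
  using assms inj by (simp_all add: relabel_def relabel_functional_def Let_def inv_into_f_f)

lemma relabel_functional:
  assumes f: "f \<in> bounded_functionals X" and X: "separated_bimodule X"
  shows "relabel_functional h X f \<in> bounded_functionals (relabel h X)"
proof -
  obtain K where K: "\<And>x. x \<in> bcarrier X \<Longrightarrow> cmod (f x) \<le> K * bnorm X x"
    using functional_bound[OF f] by blast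
  show ?thesis
    by (rule functionalI[where K = K])
      (use f K separated_bimodule.add_closed[OF X] separated_bimodule.scale_closed[OF X]
        in \<open>auto simp: relabel_simps functional_add functional_scale\<close>,
        simp add: relabel_functional_def)
qed

lemma separated_bimodule_relabel:
  assumes "separated_bimodule X"
  shows "separated_bimodule (relabel h X)"
proof -
  interpret separated_bimodule X by fact
  show ?thesis
  proof
    fix u v
    assume uv: "u \<in> bcarrier (relabel h X)" "v \<in> bcarrier (relabel h X)"
      and eq: "\<And>f. f \<in> bounded_functionals (relabel h X) \<Longrightarrow> f u = f v"
    from uv obtain x y where xy: "x \<in> bcarrier X" "u = h x" "y \<in> bcarrier X" "v = h y" by auto
    have "x = y"
      using xy(1,3)
    proof (rule separation)
      fix f assume "f \<in> bounded_functionals X"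
      from eq[OF relabel_functional[OF this assms]] show "f x = f y"
        using xy by (simp add: relabel_simps)
    qed
    then show "u = v" using xy by simp
  qed (use nonempty in \<open>auto simp: relabel_simps add_closed scale_closed norm_nonneg norm_scale_le\<close>)
qed

end

lemma bounded_functionals_regular:
  "bounded_functionals (regular_bimodule m) = {f. bounded_clinear f}"
proof -
  have "bounded_clinear f" if "f \<in> bounded_functionals (regular_bimodule m)" for f
    using functional_bound[OF that] that
    by (auto simp: bounded_functionals_def regular_bimodule_def intro!: bounded_clinearI)
  moreover have "f \<in> bounded_functionals (regular_bimodule m)" if "bounded_clinear f" for f
    using bounded_clinear_add[OF that] bounded_clinear_scale[OF that] bounded_clinear_bound[OF that]
    by (auto simp: bounded_functionals_def regular_bimodule_def)
  ultimately show ?thesis by auto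
qed

lemma separated_bimodule_regular: "separated_bimodule (regular_bimodule m)"
proof
  fix x y assume eq: "\<And>f. f \<in> bounded_functionals (regular_bimodule m) \<Longrightarrow> f x = f y"
  show "x = y"
  proof (rule ccontr)
    assume "x \<noteq> y"
    then obtain f :: "'a \<Rightarrow> complex" where f: "bounded_clinear f" "f (x - y) \<noteq> 0"
      using exists_bounded_clinear_nonzero[of "x - y"] by auto
    with eq[of f] bounded_clinear_add[OF f(1), of "x - y" y] show False
      by (simp add: bounded_functionals_regular)
  qed
qed (simp_all add: regular_bimodule_def norm_scaleC)

section \<open>The iterated duals for the product given by a functional\<close>

text \<open>Here \<open>\<iota>\<close> is the canonical embedding of the algebra into its \<open>2n\<close>-th dual, and \<open>\<kappa>\<close> that of
  its dual into the \<open>2n+1\<close>-st dual.\<close>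

locale even_level = separated_bimodule X
  for X :: "('a::complex_banach, 'v) bimodule" +
  fixes \<phi> :: "'a \<Rightarrow> complex" and \<iota> :: "'a \<Rightarrow> 'v" and \<kappa> :: "('a \<Rightarrow> complex) \<Rightarrow> 'v \<Rightarrow> complex"
  assumes \<iota>_closed: "\<iota> a \<in> bcarrier X"
    and \<kappa>_functional: "bounded_clinear \<psi> \<Longrightarrow> \<kappa> \<psi> \<in> bounded_functionals X"
    and \<kappa>_\<iota>: "bounded_clinear \<psi> \<Longrightarrow> \<kappa> \<psi> (\<iota> a) = \<psi> a"
    and lact_eq: "x \<in> bcarrier X \<Longrightarrow> lact X a x = bscale X (\<phi> a) x"
    and ract_eq: "x \<in> bcarrier X \<Longrightarrow> ract X x a = bscale X (\<kappa> \<phi> x) (\<iota> a)"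

text \<open>Here \<open>\<kappa>\<close> embeds the dual of the algebra into its \<open>2n+1\<close>-st dual, and \<open>\<eta>\<close> the algebra into
  its \<open>2n+2\<close>-nd dual.\<close>

locale odd_level = separated_bimodule X
  for X :: "('a::complex_banach, 'v) bimodule" +
  fixes \<phi> :: "'a \<Rightarrow> complex" and \<eta> :: "'a \<Rightarrow> 'v \<Rightarrow> complex" and \<kappa> :: "('a \<Rightarrow> complex) \<Rightarrow> 'v"
  assumes \<kappa>_closed: "bounded_clinear \<psi> \<Longrightarrow> \<kappa> \<psi> \<in> bcarrier X"
    and \<eta>_functional: "\<eta> a \<in> bounded_functionals X"
    and \<eta>_\<kappa>: "bounded_clinear \<psi> \<Longrightarrow> \<eta> a (\<kappa> \<psi>) = \<psi> a"
    and lact_eq: "x \<in> bcarrier X \<Longrightarrow> lact X a x = bscale X (\<eta> a x) (\<kappa> \<phi>)"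
    and ract_eq: "x \<in> bcarrier X \<Longrightarrow> ract X x a = bscale X (\<phi> a) x"

text \<open>Both embeddings are identities. The left factor of a product contributes only its value
  under \<phi>, so the left action scales and the right action by \<open>a\<close> returns a
  multiple of \<open>a\<close>.\<close>

lemma even_level_regular: "even_level (regular_bimodule (phi_mult \<phi>)) \<phi> (\<lambda>a. a) (\<lambda>\<psi>. \<psi>)"
  by (intro even_level.intro separated_bimodule_regular even_level_axioms.intro)
    (simp_all add: bounded_functionals_regular, simp_all add: regular_bimodule_def phi_mult_def)

text \<open>Dualizing swaps the sides: f . a at x is f (a . x) = \<phi> a f x, and a . f at x is f
  (x . a) = \<kappa> \<phi> x f (\<iota> a). So \<kappa> is kept, and \<iota> a becomes evaluation
  at \<iota> a.\<close>

lemma odd_level_dual: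
  assumes "even_level X \<phi> \<iota> \<kappa>" and \<phi>: "bounded_clinear \<phi>"
  shows "odd_level (dual_bimodule X) \<phi> (\<lambda>a. dual_eval X (\<iota> a)) \<kappa>"
proof -
  interpret even_level X \<phi> \<iota> \<kappa> by fact
  show ?thesis
  proof (intro odd_level.intro separated_bimodule_dual odd_level_axioms.intro)
    fix f a assume "f \<in> bcarrier (dual_bimodule X)"
    then have f: "f \<in> bounded_functionals X" by simp
    show "lact (dual_bimodule X) a f = bscale (dual_bimodule X) (dual_eval X (\<iota> a) f) (\<kappa> \<phi>)"
      using f functional_outside[OF \<kappa>_functional[OF \<phi>]]
      by (auto simp: fun_eq_iff ract_eq functional_scale[OF f \<iota>_closed] dual_bimodule_def)
    show "ract (dual_bimodule X) f a = bscale (dual_bimodule X) (\<phi> a) f"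
      using f functional_outside[OF f]
      by (auto simp: fun_eq_iff lact_eq functional_scale[OF f] dual_bimodule_def)
  qed (simp_all add: dual_eval_functional \<iota>_closed \<kappa>_functional \<kappa>_\<iota>)
qed

text \<open>As before with the sides exchanged: f . a at x is f (a . x) = \<eta> a x f (\<kappa>
  \<phi>). So \<eta> is kept, and \<kappa> \<psi> becomes an evaluation.\<close>

lemma even_level_dual:
  assumes "odd_level X \<phi> \<eta> \<kappa>" and \<phi>: "bounded_clinear \<phi>"
  shows "even_level (dual_bimodule X) \<phi> \<eta> (\<lambda>\<psi>. dual_eval X (\<kappa> \<psi>))"
proof -
  interpret odd_level X \<phi> \<eta> \<kappa> by fact
  show ?thesis
  proof (intro even_level.intro separated_bimodule_dual even_level_axioms.intro)
    fix f a assume "f \<in> bcarrier (dual_bimodule X)"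
    then have f: "f \<in> bounded_functionals X" by simp
    show "lact (dual_bimodule X) a f = bscale (dual_bimodule X) (\<phi> a) f"
      using f functional_outside[OF f]
      by (auto simp: fun_eq_iff ract_eq functional_scale[OF f] dual_bimodule_def)
    show "ract (dual_bimodule X) f a = bscale (dual_bimodule X) (dual_eval X (\<kappa> \<phi>) f) (\<eta> a)"
      using f functional_outside[OF \<eta>_functional]
      by (auto simp: fun_eq_iff lact_eq functional_scale[OF f \<kappa>_closed[OF \<phi>]] dual_bimodule_def)
  qed (simp_all add: dual_eval_functional \<eta>_functional \<kappa>_closed \<eta>_\<kappa>)
qed

lemma even_level_relabel:
  assumes "even_level X \<phi> \<iota> \<kappa>" and h: "inj_on h (bcarrier X)"
  shows "even_level (relabel h X) \<phi> (\<lambda>a. h (\<iota> a)) (\<lambda>\<psi>. relabel_functional h X (\<kappa> \<psi>))"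
proof -
  interpret even_level X \<phi> \<iota> \<kappa> by fact
  show ?thesis
    by (intro even_level.intro separated_bimodule_relabel[OF h] even_level_axioms.intro)
      (auto simp: relabel_simps[OF h] \<iota>_closed \<kappa>_\<iota> lact_eq ract_eq
        intro!: relabel_functional[OF h] \<kappa>_functional separated_bimodule_axioms)
qed

lemma odd_level_relabel:
  assumes "odd_level X \<phi> \<eta> \<kappa>" and h: "inj_on h (bcarrier X)" and \<phi>: "bounded_clinear \<phi>"
  shows "odd_level (relabel h X) \<phi> (\<lambda>a. relabel_functional h X (\<eta> a)) (\<lambda>\<psi>. h (\<kappa> \<psi>))"
proof -
  interpret odd_level X \<phi> \<eta> \<kappa> by fact
  show ?thesis
    by (intro odd_level.intro separated_bimodule_relabel[OF h] odd_level_axioms.intro)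
      (auto simp: relabel_simps[OF h] \<kappa>_closed \<phi> \<eta>_\<kappa> lact_eq ract_eq
        intro!: relabel_functional[OF h] \<eta>_functional separated_bimodule_axioms)
qed

text \<open>Each level arises by dualizing, which flips the parity, and renaming. The coding
  condition for \<open>Suc n\<close> contains the one for \<open>n\<close> and the injectivity of
  \<open>c n\<close>.\<close>

lemma nth_dual_level:
  assumes "dual_coding e c (phi_mult \<phi>) n" and \<phi>: "bounded_clinear \<phi>"
  shows "if even n then \<exists>\<iota> \<kappa>. even_level (nth_dual e c (phi_mult \<phi>) n) \<phi> \<iota> \<kappa>
    else \<exists>\<eta> \<kappa>. odd_level (nth_dual e c (phi_mult \<phi>) n) \<phi> \<eta> \<kappa>"
  using assms(1)
proof (induction n)
  case 0
  then have "inj_on e (bcarrier (regular_bimodule (phi_mult \<phi>)))"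
    by (auto simp: dual_coding_def intro: inj_on_subset)
  from even_level_relabel[OF even_level_regular this] show ?case by auto
next
  case (Suc n)
  then have "dual_coding e c (phi_mult \<phi>) n"
    and c: "inj_on (c n) (bcarrier (dual_bimodule (nth_dual e c (phi_mult \<phi>) n)))"
    by (auto simp: dual_coding_def)
  with Suc.IH consider \<iota> \<kappa> where "even n" "even_level (nth_dual e c (phi_mult \<phi>) n) \<phi> \<iota> \<kappa>"
    | \<eta> \<kappa> where "odd n" "odd_level (nth_dual e c (phi_mult \<phi>) n) \<phi> \<eta> \<kappa>"
    by (auto split: if_splits)
  then show ?case
  proof cases
    case 1
    with odd_level_relabel[OF odd_level_dual[OF _ \<phi>] c \<phi>] show ?thesis by auto
  next
    case 2
    with even_level_relabel[OF even_level_dual[OF _ \<phi>] c] show ?thesis by auto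
  qed
qed

section \<open>Derivations\<close>

lemma (in odd_level) derivation_inner:
  assumes D: "derivation (phi_mult \<phi>) X D" and \<phi>: "bounded_clinear \<phi>" "\<phi> \<noteq> (\<lambda>_. 0)"
  shows "inner_derivation X D"
proof -
  obtain w where w: "\<phi> w \<noteq> 0" using \<phi>(2) by auto
  \<comment> \<open>Normalized so that the term \<phi> u D a of the product rule is D a
    itself.\<close>
  define u where "u = inverse (\<phi> w) *\<^sub>C w"
  have u: "\<phi> u = 1" using w by (simp add: u_def bounded_clinear_scale[OF \<phi>(1)])
  have DX: "D a \<in> bcarrier X" for a using D by (auto simp: derivation_def)
  \<comment> \<open>\<open>D\<close> at the product of \<open>a\<close> and \<open>u\<close>,
    computed by homogeneity and by the product rule.\<close>
  have eq: "bscale X (\<phi> a) (D u) = badd X (bscale X (\<phi> u) (D a)) (bscale X (\<eta> a (D u)) (\<kappa> \<phi>))" for a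
  proof -
    have "D (phi_mult \<phi> a u) = bscale X (\<phi> a) (D u)"
      using D by (simp add: derivation_def phi_mult_def)
    then show ?thesis using D DX by (simp add: derivation_def lact_eq ract_eq)
  qed
  let ?x = "bscale X (- 1) (D u)"
  have x: "?x \<in> bcarrier X" by (intro scale_closed DX)
  have "D a = badd X (lact X a ?x) (bscale X (- 1) (ract X ?x a))" for a
  proof (rule separation)
    show "badd X (lact X a ?x) (bscale X (- 1) (ract X ?x a)) \<in> bcarrier X"
      by (simp add: lact_eq ract_eq x add_closed scale_closed \<kappa>_closed[OF \<phi>(1)])
  next
    fix f assume f: "f \<in> bounded_functionals X"
    have "\<phi> a * f (D u) = f (D a) + \<eta> a (D u) * f (\<kappa> \<phi>)"
      using arg_cong[OF eq[of a], of f] u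
      by (simp add: functional_add[OF f] functional_scale[OF f] DX scale_closed \<kappa>_closed[OF \<phi>(1)])
    then show "f (D a) = f (badd X (lact X a ?x) (bscale X (- 1) (ract X ?x a)))"
      by (simp add: lact_eq ract_eq x functional_add[OF f] functional_scale[OF f]
          functional_scale[OF \<eta>_functional] DX scale_closed \<kappa>_closed[OF \<phi>(1)])
  qed (rule DX)
  with x show ?thesis unfolding inner_derivation_def by blast
qed

text \<open>In the product rule the right action contributes the factor \<kappa> \<phi> (D a) =
  \<psi> a \<phi> u = 0, and the left action gives \<phi> a D b, which is D at \<phi> a b.\<close>

lemma (in even_level) rank_one_derivation:
  assumes \<phi>: "bounded_clinear \<phi>" and \<psi>: "bounded_clinear \<psi>" and u: "\<phi> u = 0"
  shows "derivation (phi_mult \<phi>) X (\<lambda>a. bscale X (\<psi> a) (\<iota> u))" (is "derivation _ X ?D")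
proof -
  have DX: "?D a \<in> bcarrier X" for a by (intro scale_closed \<iota>_closed)
  have eqI: "x = y" if "x \<in> bcarrier X" "y \<in> bcarrier X"
    "\<And>f. f \<in> bounded_functionals X \<Longrightarrow> f x = f y" for x y
    using that by (rule separation)
  note simps = functional_add functional_scale DX \<iota>_closed add_closed scale_closed
    bounded_clinear_add[OF \<psi>] bounded_clinear_scale[OF \<psi>] algebra_simps
  have "?D (a + b) = badd X (?D a) (?D b)" for a b
    by (rule eqI) (simp_all add: simps)
  moreover have "?D (z *\<^sub>C a) = bscale X z (?D a)" for z a
    by (rule eqI) (simp_all add: simps)
  moreover have "?D (phi_mult \<phi> a b) = badd X (ract X (?D a) b) (lact X a (?D b))" for a b
    by (rule eqI) (simp_all add: simps phi_mult_def lact_eq ract_eq \<kappa>_functional[OF \<phi>] \<kappa>_\<iota>[OF \<phi>] u)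
  moreover have "bnorm X (?D a) \<le> (onorm \<psi> * bnorm X (\<iota> u)) * norm a" for a
    using norm_scale_le[OF \<iota>_closed, of "\<psi> a" u]
      mult_right_mono[OF bounded_clinear_bound[OF \<psi>, of a] norm_nonneg[OF \<iota>_closed, of u]]
    by (simp add: mult_ac)
  ultimately show ?thesis using DX unfolding derivation_def by blast
qed

text \<open>On the kernel of \<phi> the left action vanishes, so an implementing \<open>x\<close>
  gives \<psi> a \<iota> u = - s \<iota> a there, with s = \<kappa> \<phi> x. At \<open>v\<close>
  independence forces s = 0, which at \<open>u\<close> contradicts \<psi> u \<noteq> 0.\<close>

lemma (in even_level) rank_one_not_inner:
  assumes \<phi>: "bounded_clinear \<phi>" and \<psi>: "bounded_clinear \<psi>"
    and u: "\<phi> u = 0" "\<psi> u \<noteq> 0" and v: "\<phi> v = 0"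
    and indep: "\<And>r s. r *\<^sub>C u + s *\<^sub>C v = 0 \<Longrightarrow> s = 0"
  shows "\<not> inner_derivation X (\<lambda>a. bscale X (\<psi> a) (\<iota> u))"
proof
  assume "inner_derivation X (\<lambda>a. bscale X (\<psi> a) (\<iota> u))"
  then obtain x where x: "x \<in> bcarrier X"
    and eq: "\<And>a. bscale X (\<psi> a) (\<iota> u) = badd X (lact X a x) (bscale X (- 1) (ract X x a))"
    by (auto simp: inner_derivation_def)
  let ?s = "\<kappa> \<phi> x"
  \<comment> \<open>Applying \<open>\<kappa> \<theta>\<close> pulls the identity back to the
    algebra.\<close>
  have scalar: "\<psi> a * \<theta> u + ?s * \<theta> a = 0" if a: "\<phi> a = 0" and \<theta>: "bounded_clinear \<theta>" for a \<theta>
    using arg_cong[OF eq[of a], of "\<kappa> \<theta>"] a x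
    by (simp add: lact_eq ract_eq functional_add[OF \<kappa>_functional[OF \<theta>]]
        functional_scale[OF \<kappa>_functional[OF \<theta>]] \<iota>_closed scale_closed \<kappa>_\<iota>[OF \<theta>])
  \<comment> \<open>By \<open>scalar\<close> at \<open>v\<close> every \<theta> vanishes on this
    vector.\<close>
  have "\<psi> v *\<^sub>C u + ?s *\<^sub>C v = 0"
  proof (rule ccontr)
    assume "\<not> ?thesis"
    then obtain \<theta> :: "'a \<Rightarrow> complex" where "bounded_clinear \<theta>" "\<theta> (\<psi> v *\<^sub>C u + ?s *\<^sub>C v) \<noteq> 0"
      using exists_bounded_clinear_nonzero by blast
    then show False
      using scalar[OF v] by (simp add: bounded_clinear_add bounded_clinear_scale)
  qed
  then have "?s = 0" by (rule indep)
  \<comment> \<open>For a = u and \<theta> = \<psi> the identity now reads \<psi> u * \<psi> u =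
    0.\<close>
  with scalar[OF u(1) \<psi>] u(2) show False by simp
qed

text \<open>Two members of a basis. Independence is stated through the coefficient of
  \<open>v\<close>, the form used to refute innerness.\<close>

lemma dim_at_least_2_independent:
  assumes "dim_at_least 2 V"
  obtains u v where "u \<in> V" "v \<in> V" "u \<noteq> 0" "\<And>r s. r *\<^sub>C u + s *\<^sub>C v = 0 \<Longrightarrow> s = 0"
proof -
  obtain b where b: "\<not> complex_vector.dependent b" "complex_vector.span b = V"
    and card: "infinite b \<or> 2 \<le> card b"
    using assms by (auto simp: dim_at_least_def)
  have "\<exists>B\<subseteq>b. card B = 2"
    using card infinite_arbitrarily_large[of b 2] obtain_subset_with_card_n[of 2 b] by metis
  then obtain u v where uv: "{u, v} \<subseteq> b" "u \<noteq> v" by (auto simp: card_2_iff)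
  have ind: "\<not> complex_vector.dependent {u, v}"
    using complex_vector.independent_mono[OF b(1) uv(1)] .
  have "s = 0" if "r *\<^sub>C u + s *\<^sub>C v = 0" for r s
    using complex_vector.independentD[OF ind _ subset_refl, of "\<lambda>x. if x = u then r else s" v]
      that uv(2) by simp
  moreover have "u \<noteq> 0" using complex_vector.dependent_zero b(1) uv(1) by blast
  moreover have "u \<in> V" "v \<in> V" using complex_vector.span_superset b(2) uv(1) by blast+
  ultimately show thesis using that by blast
qed

theorem theorem2:
  fixes \<phi> :: "'a::complex_banach \<Rightarrow> complex"
    and e :: "'a \<Rightarrow> 'u"
    and c :: "nat \<Rightarrow> ('u \<Rightarrow> complex) \<Rightarrow> 'u"
  assumes "bounded_clinear \<phi>" and "\<phi> \<noteq> (\<lambda>_. 0)" and "onorm \<phi> \<le> 1"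
  shows "(\<forall>n\<ge>1. dual_coding e c (phi_mult \<phi>) (2 * n - 1) \<longrightarrow>
            n_weakly_amenable e c (phi_mult \<phi>) (2 * n - 1)) \<and>
         (dim_at_least 2 {x. \<phi> x = 0} \<longrightarrow>
            (\<forall>n\<ge>1. dual_coding e c (phi_mult \<phi>) (2 * n) \<longrightarrow>
              \<not> n_weakly_amenable e c (phi_mult \<phi>) (2 * n)))"
proof (intro conjI allI impI)
  fix n :: nat assume "1 \<le> n" and "dual_coding e c (phi_mult \<phi>) (2 * n - 1)"
  \<comment> \<open>\<open>1 \<le> n\<close> makes \<open>2 * n - 1\<close> odd; truncated
    subtraction would give level 0 for \<open>n = 0\<close>.\<close>
  with nth_dual_level[OF this(2) assms(1)] obtain \<eta> \<kappa>
    where "odd_level (nth_dual e c (phi_mult \<phi>) (2 * n - 1)) \<phi> \<eta> \<kappa>"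
    by auto
  from odd_level.derivation_inner[OF this _ assms(1,2)]
  show "n_weakly_amenable e c (phi_mult \<phi>) (2 * n - 1)"
    by (simp add: n_weakly_amenable_def)
next
  fix n :: nat
  assume "dim_at_least 2 {x. \<phi> x = 0}" and "dual_coding e c (phi_mult \<phi>) (2 * n)"
  from nth_dual_level[OF this(2) assms(1)] obtain \<iota> \<kappa>
    where level: "even_level (nth_dual e c (phi_mult \<phi>) (2 * n)) \<phi> \<iota> \<kappa>"
    by auto
  from \<open>dim_at_least 2 _\<close> obtain u v where uv: "\<phi> u = 0" "\<phi> v = 0" "u \<noteq> 0"
    and indep: "\<And>r s. r *\<^sub>C u + s *\<^sub>C v = 0 \<Longrightarrow> s = 0"
    by (rule dim_at_least_2_independent) auto
  obtain \<psi> :: "'a \<Rightarrow> complex" where \<psi>: "bounded_clinear \<psi>" "\<psi> u \<noteq> 0"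
    using exists_bounded_clinear_nonzero[OF uv(3)] .
  have "\<not> inner_derivation (nth_dual e c (phi_mult \<phi>) (2 * n))
      (\<lambda>a. bscale (nth_dual e c (phi_mult \<phi>) (2 * n)) (\<psi> a) (\<iota> u))"
    by (rule even_level.rank_one_not_inner[OF level assms(1) \<psi>(1) uv(1) \<psi>(2) uv(2)])
      (rule indep)
  with even_level.rank_one_derivation[OF level assms(1) \<psi>(1) uv(1)]
  show "\<not> n_weakly_amenable e c (phi_mult \<phi>) (2 * n)"
    unfolding n_weakly_amenable_def by blast
qed

end
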